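(* Let $R$ be a non-local ring. Then the zero-divisor graph $\Gamma(R)$ is threshold if and only if $R\cong \mathbb{F}_2\times\mathbb{F}_q$, where $q\geq 3$ and $\mathbb{F}_q$ is the field with $q$ elements.
   Context: "Ring" means finite commutative ring with unity, and "graph" means finite simple undirected graph. A ring is local if it has a unique maximal ideal, and non-local otherwise. For a ring $R$, the zero-divisor graph $\Gamma(R)$ has as vertices the zero-divisors of $R$, that is, the non-zero elements $a\in R$ for which there exists $b\neq 0$ in $R$ with $ab=0$; two distinct vertices $a,b$ are adjacent if and only if $ab=0$. A graph $G$ is a threshold graph (is threshold) if there exist $t\in\mathbb{R}$ and, for each vertex $v$, a weight $w(v)\in\mathbb{R}$ such that, for distinct vertices $u,v$, $uv$ is an edge of $G$ if and only if $w(u)+w(v)>t$.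
   Formalization: The case R ≅ F_2×F_2 (q = 2) is added on the right-hand side, because that ring is non-local and its zero-divisor graph is a single edge, which is threshold; the zero ring is excluded. *)

theory Defs
  imports
    Complex_Main
    "HOL-Algebra.Chinese_Remainder"
    "HOL-Number_Theory.Residues"
    "Graph_Theory.Pair_Digraph"
begin

definition local_ring :: "('a, 'm) ring_scheme \<Rightarrow> bool"
  where "local_ring R \<longleftrightarrow> (\<exists>!I. maximalideal I R)"

(* Zero itself is excluded: only the non-zero zero-divisors are vertices of the graph. *)
definition zero_divisors :: "('a, 'm) ring_scheme \<Rightarrow> 'a set"
  where "zero_divisors R =
    {a \<in> carrier R. a \<noteq> \<zero>\<^bsub>R\<^esub> \<and> (\<exists>b \<in> carrier R. b \<noteq> \<zero>\<^bsub>R\<^esub> \<and> a \<otimes>\<^bsub>R\<^esub> b = \<zero>\<^bsub>R\<^esub>)}"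

(* A simple undirected graph is a pair_graph: a finite, loop-free, symmetric digraph whose
   arcs are pairs of vertices. *)
definition zero_divisor_graph :: "('a, 'm) ring_scheme \<Rightarrow> 'a pair_pre_digraph"
  where "zero_divisor_graph R =
    \<lparr> pverts = zero_divisors R,
      parcs = {(a, b). a \<in> zero_divisors R \<and> b \<in> zero_divisors R \<and> a \<noteq> b \<and>
                 a \<otimes>\<^bsub>R\<^esub> b = \<zero>\<^bsub>R\<^esub>} \<rparr>"

definition threshold_graph :: "'v pair_pre_digraph \<Rightarrow> bool"
  where "threshold_graph G \<longleftrightarrow>
    (\<exists>(t :: real) (w :: 'v \<Rightarrow> real). \<forall>u \<in> pverts G. \<forall>v \<in> pverts G. u \<noteq> v \<longrightarrow>
       ((u, v) \<in> parcs G \<longleftrightarrow> w u + w v > t))"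

lemma pair_graph_zero_divisor_graph:
  assumes "cring R" "finite (carrier R)"
  shows "pair_graph (zero_divisor_graph R)"
proof -
  interpret cring R by fact
  have fin: "finite (zero_divisors R)"
    using assms(2) by (simp add: zero_divisors_def)
  have "finite (parcs (zero_divisor_graph R))"
    by (rule finite_subset[of _ "zero_divisors R \<times> zero_divisors R"])
       (use fin in \<open>auto simp: zero_divisor_graph_def\<close>)
  moreover have "sym (parcs (zero_divisor_graph R))"
    by (auto simp: sym_def zero_divisor_graph_def zero_divisors_def m_comm)
  ultimately show ?thesis
    using fin
    by unfold_locales (auto simp: zero_divisor_graph_def symmetric_def)
qed

(* The field F_2 is residue_ring 2. The product F_2 x F_2 is a non-local ring whose
   zero-divisor graph is a single edge, hence threshold; a characterization of the non-local
   rings with threshold zero-divisor graph as the products F_2 x F_q therefore has to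
   admit q = 2.  For F_q with q > 2 one can take any field F :: int ring with q elements:
   every finite ring is isomorphic to one whose carrier is a set of integers. *)
lemma threshold_zero_divisor_graph_F2_F2:
  "threshold_graph (zero_divisor_graph (RDirProd (residue_ring 2) (residue_ring 2)))"
proof -
  let ?R = "RDirProd (residue_ring 2) (residue_ring 2)"
  have c: "carrier (residue_ring 2) = {0, 1}"
    by (auto simp: residue_ring_def)
  have "zero_divisors ?R \<subseteq> {(0, 1), (1, 0)}"
    by (auto simp: zero_divisors_def RDirProd_carrier c)
       (auto simp: RDirProd_def DirProd_def monoid.defs residue_ring_def)
  moreover have "(0, 1) \<otimes>\<^bsub>?R\<^esub> (1, 0) = \<zero>\<^bsub>?R\<^esub>" "(1, 0) \<otimes>\<^bsub>?R\<^esub> (0, 1) = \<zero>\<^bsub>?R\<^esub>"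
    by (auto simp: RDirProd_def DirProd_def monoid.defs residue_ring_def)
  ultimately show ?thesis
    unfolding threshold_graph_def zero_divisor_graph_def
    by (intro exI[of _ 1] exI[of _ "\<lambda>_. 1"]) auto
qed

end

theory Submission
  imports Defs
begin

text \<open>A threshold graph has no alternating 4-cycle, i.e. no vertices a, b, c, d with ab, cd
  edges and ac, bd non-edges. A finite non-local ring has a non-trivial idempotent and hence splits
  as a product of two corners \<open>eR\<close> and \<open>fR\<close> with \<open>e + f = 1\<close>. If both corners contain elements
  \<open>x \<noteq> 0, e\<close> and \<open>y \<noteq> 0, f\<close>, then e, f, x, y is an alternating 4-cycle of the zero-divisor
  graph. Otherwise \<open>eR = {0, e}\<close>, say; if \<open>x y = 0\<close> with non-zero \<open>x, y \<in> fR\<close>, then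
  \<open>e + x, y, e, f\<close> is one, so \<open>fR\<close> is a finite domain. Conversely the zero-divisor graph of
  \<open>F\<^sub>2 \<times> F\<close> is a star.\<close>

section \<open>Threshold graphs, and unfolding rules for the graph and the product ring\<close>

lemma threshold_graph_no_alternating_4_cycle:
  assumes "threshold_graph G" and "{a, b, c, d} \<subseteq> pverts G"
    and "a \<noteq> b" "c \<noteq> d" "a \<noteq> c" "b \<noteq> d"
    and "(a, b) \<in> parcs G" "(c, d) \<in> parcs G"
    and "(a, c) \<notin> parcs G" "(b, d) \<notin> parcs G"
  shows False
proof -
  obtain t :: real and w where
    "\<forall>u\<in>pverts G. \<forall>v\<in>pverts G. u \<noteq> v \<longrightarrow> ((u, v) \<in> parcs G \<longleftrightarrow> w u + w v > t)"
    using assms(1) unfolding threshold_graph_def by blast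
  then have "w a + w b > t" "w c + w d > t" "\<not> w a + w c > t" "\<not> w b + w d > t"
    using assms(2-) by auto
  \<comment> \<open>The two edges and the two non-edges cover the same four vertices, so
    \<open>w a + w b + w c + w d\<close> would be both above and at most
    \<open>2 * t\<close>.\<close>
  then show False by linarith
qed

lemma zero_divisor_graph_sel [simp]:
  "pverts (zero_divisor_graph R) = zero_divisors R"
  "(a, b) \<in> parcs (zero_divisor_graph R) \<longleftrightarrow>
     a \<in> zero_divisors R \<and> b \<in> zero_divisors R \<and> a \<noteq> b \<and> a \<otimes>\<^bsub>R\<^esub> b = \<zero>\<^bsub>R\<^esub>"
  by (auto simp: zero_divisor_graph_def)

lemma zero_divisorsI:
  assumes "a \<in> carrier R" "b \<in> carrier R" "a \<noteq> \<zero>\<^bsub>R\<^esub>" "b \<noteq> \<zero>\<^bsub>R\<^esub>" "a \<otimes>\<^bsub>R\<^esub> b = \<zero>\<^bsub>R\<^esub>"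
  shows "a \<in> zero_divisors R"
  using assms by (auto simp: zero_divisors_def)

lemma RDirProd_sel [simp]:
  "carrier (RDirProd R S) = carrier R \<times> carrier S"
  "\<one>\<^bsub>RDirProd R S\<^esub> = (\<one>\<^bsub>R\<^esub>, \<one>\<^bsub>S\<^esub>)"
  "\<zero>\<^bsub>RDirProd R S\<^esub> = (\<zero>\<^bsub>R\<^esub>, \<zero>\<^bsub>S\<^esub>)"
  "(a, b) \<otimes>\<^bsub>RDirProd R S\<^esub> (c, d) = (a \<otimes>\<^bsub>R\<^esub> c, b \<otimes>\<^bsub>S\<^esub> d)"
  "(a, b) \<oplus>\<^bsub>RDirProd R S\<^esub> (c, d) = (a \<oplus>\<^bsub>R\<^esub> c, b \<oplus>\<^bsub>S\<^esub> d)"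
  by (simp_all add: RDirProd_def DirProd_def monoid.defs)

lemma residue_ring_2_sel:
  "carrier (residue_ring 2) = {0, 1}"
  "\<one>\<^bsub>residue_ring 2\<^esub> = 1" "\<zero>\<^bsub>residue_ring 2\<^esub> = 0"
  "a \<otimes>\<^bsub>residue_ring 2\<^esub> b = a * b mod 2"
  "a \<oplus>\<^bsub>residue_ring 2\<^esub> b = (a + b) mod 2"
  by (auto simp: residue_ring_def)

subsection \<open>The product of \<open>F\<^sub>2\<close> and a field\<close>

lemma ring_iso_zero:
  assumes "ring R" "ring S" "h \<in> ring_iso R S"
  shows "h \<zero>\<^bsub>R\<^esub> = \<zero>\<^bsub>S\<^esub>"
  using assms ring_hom_zero[of h R S] by (simp add: ring_iso_def)

lemma zero_divisors_ring_iso: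
  assumes "ring R" "ring S" and h: "h \<in> ring_iso R S" and "a \<in> zero_divisors R"
  shows "h a \<in> zero_divisors S"
proof -
  note hE = ring_iso_memE[OF h]
  have inj: "inj_on h (carrier R)"
    using hE(5) by (simp add: bij_betw_def)
  obtain b where a: "a \<in> carrier R" "a \<noteq> \<zero>\<^bsub>R\<^esub>" and b: "b \<in> carrier R" "b \<noteq> \<zero>\<^bsub>R\<^esub>"
    and ab: "a \<otimes>\<^bsub>R\<^esub> b = \<zero>\<^bsub>R\<^esub>"
    using assms(4) by (auto simp: zero_divisors_def)
  have z: "h \<zero>\<^bsub>R\<^esub> = \<zero>\<^bsub>S\<^esub>" "\<zero>\<^bsub>R\<^esub> \<in> carrier R"
    using ring_iso_zero assms ring.ring_simprules(2) by blast+
  show ?thesis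
  proof (rule zero_divisorsI)
    show "h a \<otimes>\<^bsub>S\<^esub> h b = \<zero>\<^bsub>S\<^esub>"
      using hE(2)[OF a(1) b(1)] ab z by simp
    show "h a \<noteq> \<zero>\<^bsub>S\<^esub>" "h b \<noteq> \<zero>\<^bsub>S\<^esub>"
      using inj_onD[OF inj] a b z by metis+
  qed (use a b hE(1) in auto)
qed

lemma threshold_zero_divisor_graph_ring_iso:
  assumes "ring R" "ring S" and h: "h \<in> ring_iso R S"
    and "threshold_graph (zero_divisor_graph S)"
  shows "threshold_graph (zero_divisor_graph R)"
proof -
  note hE = ring_iso_memE[OF h]
  have inj: "inj_on h (carrier R)"
    using hE(5) by (simp add: bij_betw_def)
  obtain t :: real and w where w: "\<And>u v. u \<in> zero_divisors S \<Longrightarrow> v \<in> zero_divisors S \<Longrightarrow>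
      u \<noteq> v \<Longrightarrow> u \<otimes>\<^bsub>S\<^esub> v = \<zero>\<^bsub>S\<^esub> \<longleftrightarrow> w u + w v > t"
    using assms(4) unfolding threshold_graph_def by auto
  have "u \<otimes>\<^bsub>R\<^esub> v = \<zero>\<^bsub>R\<^esub> \<longleftrightarrow> w (h u) + w (h v) > t"
    if uv: "u \<in> zero_divisors R" "v \<in> zero_divisors R" "u \<noteq> v" for u v
  proof -
    have c: "u \<in> carrier R" "v \<in> carrier R"
      using uv by (auto simp: zero_divisors_def)
    have "u \<otimes>\<^bsub>R\<^esub> v = \<zero>\<^bsub>R\<^esub> \<longleftrightarrow> h (u \<otimes>\<^bsub>R\<^esub> v) = h \<zero>\<^bsub>R\<^esub>"
      using inj_on_eq_iff[OF inj] c ring.ring_simprules(2,5)[OF \<open>ring R\<close>] by metis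
    also have "\<dots> \<longleftrightarrow> h u \<otimes>\<^bsub>S\<^esub> h v = \<zero>\<^bsub>S\<^esub>"
      using hE(2) c ring_iso_zero[OF assms(1-3)] by simp
    also have "\<dots> \<longleftrightarrow> w (h u) + w (h v) > t"
      using w zero_divisors_ring_iso[OF assms(1-3)] uv inj_on_eq_iff[OF inj] c by metis
    finally show ?thesis .
  qed
  then show ?thesis
    unfolding threshold_graph_def by (intro exI[of _ t] exI[of _ "w \<circ> h"]) auto
qed

lemma threshold_zero_divisor_graph_F2_times_field:
  assumes "field F"
  shows "threshold_graph (zero_divisor_graph (RDirProd (residue_ring 2) F))"
proof -
  interpret F: field F by fact
  let ?P = "RDirProd (residue_ring 2) F"
  have zd: "(i = 1 \<and> x = \<zero>\<^bsub>F\<^esub>) \<or> (i = 0 \<and> x \<in> carrier F \<and> x \<noteq> \<zero>\<^bsub>F\<^esub>)"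
    if "(i, x) \<in> zero_divisors ?P" for i x
    using that F.integral_iff by (auto simp: zero_divisors_def residue_ring_2_sel)
  \<comment> \<open>The first coordinate serves as weight: the centre \<open>(1, 0)\<close> of the
    star gets 1 and every leaf \<open>(0, x)\<close> gets 0. Two leaves are not adjacent because
    \<open>F\<close> has no zero divisors.\<close>
  have "\<forall>u\<in>zero_divisors ?P. \<forall>v\<in>zero_divisors ?P. u \<noteq> v \<longrightarrow>
      (u \<otimes>\<^bsub>?P\<^esub> v = \<zero>\<^bsub>?P\<^esub> \<longleftrightarrow> real_of_int (fst u) + real_of_int (fst v) > 0)"
    by (auto dest!: zd simp: residue_ring_2_sel F.integral_iff)
  then show ?thesis
    unfolding threshold_graph_def by (intro exI[of _ 0] exI[of _ "real_of_int \<circ> fst"]) auto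
qed

subsection \<open>Idempotents of finite rings\<close>

text \<open>Since \<open>local_ring\<close> is a unique-existence statement, its negation gives two
  maximal ideals only once there is one. An inclusion-maximal member of the finite set of proper
  ideals provides it.\<close>

lemma (in ring) finite_ring_exists_maximalideal:
  assumes "finite (carrier R)" and "\<one> \<noteq> \<zero>"
  shows "\<exists>I. maximalideal I R"
proof -
  let ?P = "{I. ideal I R \<and> I \<noteq> carrier R}"
  have "?P \<subseteq> Pow (carrier R)"
    by (auto dest: ideal.Icarr)
  then have "finite ?P"
    using assms(1) by (meson finite_Pow_iff finite_subset)
  moreover have "{\<zero>} \<in> ?P"
    using zeroideal assms(2) by auto
  ultimately obtain I where "I \<in> ?P" and max: "\<And>J. J \<in> ?P \<Longrightarrow> I \<subseteq> J \<Longrightarrow> J = I"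
    using finite_has_maximal[of ?P] by blast
  then have "maximalideal I R"
    by (intro maximalidealI) auto
  then show ?thesis ..
qed

text \<open>By the pigeonhole principle the powers of \<open>x\<close> are eventually periodic; an
  exponent that is a multiple of the period and lies past the preperiod gives an idempotent.\<close>

lemma (in monoid) exists_idempotent_power:
  assumes "finite (carrier G)" and x: "x \<in> carrier G"
  shows "\<exists>n::nat. n > 0 \<and> x [^] n \<otimes> x [^] n = x [^] n"
proof -
  have "\<not> inj_on (\<lambda>n::nat. x [^] n) UNIV"
    using assms finite_imageD[of "\<lambda>n::nat. x [^] n" UNIV]
    by (metis (mono_tags) finite_subset image_subsetI infinite_UNIV_nat nat_pow_closed)
  then obtain m n :: nat where "m < n" and mn: "x [^] m = x [^] n"
    by (metis inj_onI linorder_neqE_nat)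
  define p where "p = n - m"
  have p: "p > 0" "x [^] (m + p) = x [^] m"
    using \<open>m < n\<close> mn by (auto simp: p_def)
  have per: "x [^] (m + j + k * p) = x [^] (m + j)" for j k :: nat
  proof (induction k)
    case (Suc k)
    have "x [^] (m + j + Suc k * p) = x [^] (m + p) \<otimes> x [^] (j + k * p)"
      using x by (simp add: nat_pow_mult algebra_simps)
    also have "\<dots> = x [^] (m + j + k * p)"
      using x by (simp add: p nat_pow_mult algebra_simps)
    finally show ?case using Suc by simp
  qed simp
  \<comment> \<open>A multiple of the period \<open>p\<close> that is at least \<open>m\<close>, so
    doubling the exponent leaves the power unchanged. The factor \<open>Suc m\<close> keeps it
    positive even for \<open>m = 0\<close>.\<close>
  let ?N = "Suc m * p"
  have "m \<le> ?N"
    using p(1) by (cases p) auto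
  then have "x [^] (?N + Suc m * p) = x [^] ?N"
    using per[of "?N - m" "Suc m"] by simp
  then have "x [^] ?N \<otimes> x [^] ?N = x [^] ?N"
    using x by (simp only: nat_pow_mult)
  moreover have "?N > 0"
    using p(1) by simp
  ultimately show ?thesis by blast
qed

lemma (in primeideal) nat_pow_mem_imp_mem:
  assumes "x \<in> carrier R" and "x [^] (n::nat) \<in> I"
  shows "x \<in> I"
  using assms(2)
proof (induction n)
  case 0
  then show ?case
    using I_notcarr one_imp_carrier by simp
next
  case (Suc n)
  then show ?case
    using I_prime[of "x [^] n" x] assms(1) by auto
qed

lemma (in ideal) nat_pow_mem:
  assumes "x \<in> I" and "n > (0::nat)"
  shows "x [^] n \<in> I"
  using assms I_l_closed[of x "x [^] (n - 1)"] Icarr by (cases n) auto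

text \<open>Take \<open>x\<close> in one maximal ideal \<open>I\<close> but not in another one,
  \<open>J\<close>. An idempotent power of \<open>x\<close> with positive exponent stays in
  \<open>I\<close>, hence is not 1, and it stays outside the prime ideal \<open>J\<close>, hence is
  not 0.\<close>

lemma (in cring) non_local_exists_idempotent:
  assumes "finite (carrier R)" and "\<one> \<noteq> \<zero>" and "\<not> local_ring R"
  shows "\<exists>e\<in>carrier R. e \<otimes> e = e \<and> e \<noteq> \<zero> \<and> e \<noteq> \<one>"
proof -
  obtain I where I: "maximalideal I R"
    using finite_ring_exists_maximalideal assms by blast
  then obtain J where J: "maximalideal J R" and "J \<noteq> I"
    using assms(3) unfolding local_ring_def by blast
  interpret I: maximalideal I R by fact
  interpret J: primeideal J R by (rule maximalideal_prime[OF J])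
  have "\<not> I \<subseteq> J"
    using I.I_maximal[OF J.is_ideal] J.I_notcarr \<open>J \<noteq> I\<close> J.a_subset by auto
  then obtain x where x: "x \<in> I" "x \<notin> J" by blast
  then have xc: "x \<in> carrier R" using I.Icarr by blast
  obtain n :: nat where n: "n > 0" "x [^] n \<otimes> x [^] n = x [^] n"
    using exists_idempotent_power[OF assms(1) xc] by blast
  have "x [^] n \<noteq> \<zero>"
    using J.nat_pow_mem_imp_mem[OF xc] x J.zero_closed by metis
  moreover have "x [^] n \<noteq> \<one>"
    using I.nat_pow_mem[OF x(1) n(1)] I.one_imp_carrier I.I_notcarr by auto
  ultimately show ?thesis
    using n xc by blast
qed

subsection \<open>Peirce decomposition\<close>

text \<open>For idempotent \<open>e\<close> this is the ideal \<open>eR\<close> regarded as a ring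
  with its own unit \<open>e\<close>: the multiples of \<open>e\<close> are then exactly the
  elements fixed by multiplication with \<open>e\<close>.\<close>

definition corner :: "('a, 'm) ring_scheme \<Rightarrow> 'a \<Rightarrow> ('a, 'm) ring_scheme"
  where "corner R e = R\<lparr>carrier := {x \<in> carrier R. e \<otimes>\<^bsub>R\<^esub> x = x}, one := e\<rparr>"

lemma corner_sel [simp]:
  "carrier (corner R e) = {x \<in> carrier R. e \<otimes>\<^bsub>R\<^esub> x = x}"
  "\<one>\<^bsub>corner R e\<^esub> = e" "\<zero>\<^bsub>corner R e\<^esub> = \<zero>\<^bsub>R\<^esub>"
  "x \<otimes>\<^bsub>corner R e\<^esub> y = x \<otimes>\<^bsub>R\<^esub> y" "x \<oplus>\<^bsub>corner R e\<^esub> y = x \<oplus>\<^bsub>R\<^esub> y"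
  by (simp_all add: corner_def)

text \<open>The assumptions are symmetric in \<open>e\<close> and \<open>f\<close> up to
  commutativity, so facts about one corner transfer to the other. Idempotency follows on multiplying
  \<open>e \<oplus> f = \<one>\<close> by \<open>e\<close> or \<open>f\<close>.\<close>

locale complementary_idempotents = cring R for R (structure) +
  fixes e f
  assumes e_closed [simp]: "e \<in> carrier R" and f_closed [simp]: "f \<in> carrier R"
    and ef [simp]: "e \<otimes> f = \<zero>" and e_plus_f: "e \<oplus> f = \<one>"
begin

lemma fe [simp]: "f \<otimes> e = \<zero>"
  using m_comm[of f e] by simp

lemma complementary_idempotents_swap: "complementary_idempotents R f e"
  by unfold_locales (use e_plus_f in \<open>auto simp: a_comm\<close>)

lemma e_idem [simp]: "e \<otimes> e = e"
proof -
  have "e \<otimes> (e \<oplus> f) = e \<otimes> e"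
    by (subst r_distr) simp_all
  then show ?thesis
    by (simp add: e_plus_f)
qed

lemma f_idem [simp]: "f \<otimes> f = f"
  by (rule complementary_idempotents.e_idem[OF complementary_idempotents_swap])

lemma decompose: "x \<in> carrier R \<Longrightarrow> (e \<otimes> x) \<oplus> (f \<otimes> x) = x"
  using l_distr[of e f x] e_plus_f by simp

lemma corner_mult_zero:
  assumes "x \<in> carrier (corner R e)" "y \<in> carrier (corner R f)"
  shows "x \<otimes> y = \<zero>" "e \<otimes> y = \<zero>" "f \<otimes> x = \<zero>"
proof -
  have x: "x \<in> carrier R" "e \<otimes> x = x" and y: "y \<in> carrier R" "f \<otimes> y = y"
    using assms by auto
  show ey: "e \<otimes> y = \<zero>"
    using y m_assoc[of e f y] by simp
  show "f \<otimes> x = \<zero>"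
    using x m_assoc[of f e x] by simp
  have "x \<otimes> y = (e \<otimes> x) \<otimes> y"
    using x by simp
  also have "\<dots> = x \<otimes> (e \<otimes> y)"
    using x(1) y(1) by (metis e_closed m_assoc m_comm)
  finally show "x \<otimes> y = \<zero>"
    using ey x by simp
qed

lemma cring_corner: "cring (corner R e)"
proof (rule cringI)
  show "abelian_group (corner R e)"
  proof (rule abelian_groupI)
    fix x assume "x \<in> carrier (corner R e)"
    then show "\<exists>y\<in>carrier (corner R e). y \<oplus>\<^bsub>corner R e\<^esub> x = \<zero>\<^bsub>corner R e\<^esub>"
      by (intro bexI[of _ "\<ominus> x"]) (auto simp: r_minus l_neg)
  qed (auto simp: r_distr a_ac)
  show "comm_monoid (corner R e)"
  proof (rule comm_monoidI)
    fix x y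
    assume "x \<in> carrier (corner R e)" "y \<in> carrier (corner R e)"
    then show "x \<otimes>\<^bsub>corner R e\<^esub> y \<in> carrier (corner R e)"
      by (simp flip: m_assoc)
  qed (auto simp: m_assoc intro: m_comm)
qed (auto simp: l_distr)

lemma Peirce_iso:
  "(\<lambda>x. (e \<otimes> x, f \<otimes> x)) \<in> ring_iso R (RDirProd (corner R e) (corner R f))"
proof (rule ring_iso_memI)
  show "(e \<otimes> x, f \<otimes> x) \<in> carrier (RDirProd (corner R e) (corner R f))"
    if "x \<in> carrier R" for x
    using that by (simp flip: m_assoc)
  have mult: "g \<otimes> (x \<otimes> y) = (g \<otimes> x) \<otimes> (g \<otimes> y)"
    if "x \<in> carrier R" "y \<in> carrier R" "g \<in> carrier R" "g \<otimes> g = g" for x y g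
    using that by (metis m_assoc m_closed m_comm)
  show "(e \<otimes> (x \<otimes> y), f \<otimes> (x \<otimes> y)) =
      (e \<otimes> x, f \<otimes> x) \<otimes>\<^bsub>RDirProd (corner R e) (corner R f)\<^esub> (e \<otimes> y, f \<otimes> y)"
    if "x \<in> carrier R" "y \<in> carrier R" for x y
    using that mult by simp
  show "bij_betw (\<lambda>x. (e \<otimes> x, f \<otimes> x)) (carrier R)
      (carrier (RDirProd (corner R e) (corner R f)))"
  \<comment> \<open>Addition is the inverse: \<open>decompose\<close> gives one direction, and in
    the other \<open>e\<close> annihilates the second summand and \<open>f\<close> the
    first.\<close>
  proof (rule bij_betwI[where g = "\<lambda>(x, y). x \<oplus> y"])
    fix p assume "p \<in> carrier (RDirProd (corner R e) (corner R f))"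
    then obtain x y where p: "p = (x, y)"
      and x: "x \<in> carrier (corner R e)" and y: "y \<in> carrier (corner R f)"
      by auto
    show "(e \<otimes> (case p of (x, y) \<Rightarrow> x \<oplus> y), f \<otimes> (case p of (x, y) \<Rightarrow> x \<oplus> y)) = p"
      using x y corner_mult_zero[OF x y] by (simp add: p r_distr)
  qed (auto simp: decompose simp flip: m_assoc)
qed (auto simp: r_distr)

section \<open>What a threshold zero-divisor graph forces on the two corners\<close>

lemma threshold_imp_trivial_corner:
  assumes "threshold_graph (zero_divisor_graph R)" and "e \<noteq> \<zero>" "f \<noteq> \<zero>"
  shows "carrier (corner R e) = {\<zero>, e} \<or> carrier (corner R f) = {\<zero>, f}"
proof (rule ccontr)
  assume neg: "\<not> ?thesis"
  have "{\<zero>, e} \<subseteq> carrier (corner R e)" "{\<zero>, f} \<subseteq> carrier (corner R f)"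
    by auto
  with neg obtain x y where xe: "x \<in> carrier (corner R e)" "x \<noteq> \<zero>" "x \<noteq> e"
    and yf: "y \<in> carrier (corner R f)" "y \<noteq> \<zero>" "y \<noteq> f"
    by blast
  have x: "x \<in> carrier R" "e \<otimes> x = x" and y: "y \<in> carrier R" "f \<otimes> y = y"
    using xe yf by auto
  have xy: "x \<otimes> y = \<zero>" "y \<otimes> x = \<zero>"
    using corner_mult_zero[OF xe(1) yf(1)] x y m_comm by auto
  \<comment> \<open>Multiplication by \<open>e\<close> separates both pairs: it fixes
    \<open>e\<close> and \<open>x\<close>, which are non-zero, and kills \<open>f\<close> and
    \<open>y\<close>.\<close>
  have "e \<noteq> f" "x \<noteq> y"
    using e_idem ef assms(2) corner_mult_zero(2)[OF xe(1) yf(1)] x xe by metis+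
  moreover have "e \<in> zero_divisors R" "f \<in> zero_divisors R"
      "x \<in> zero_divisors R" "y \<in> zero_divisors R"
    using assms x y xe yf xy
    by (auto intro: zero_divisorsI[of e _ f] zero_divisorsI[of f _ e]
        zero_divisorsI[of x _ y] zero_divisorsI[of y _ x])
  ultimately show False
    using threshold_graph_no_alternating_4_cycle[OF assms(1), of e f x y] xe yf x y xy by auto
qed

text \<open>Replacing \<open>x\<close> by \<open>e \<oplus> x\<close> keeps its product with
  \<open>y\<close> zero but makes its product with \<open>e\<close> non-zero. It also separates the
  two vertices when \<open>x = y\<close>, so elements of square zero are covered.\<close>

lemma threshold_imp_corner_integral:
  assumes "threshold_graph (zero_divisor_graph R)" and "e \<noteq> \<zero>" "f \<noteq> \<zero>"
    and xf: "x \<in> carrier (corner R f)" and yf: "y \<in> carrier (corner R f)" and xy: "x \<otimes> y = \<zero>"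
  shows "x = \<zero> \<or> y = \<zero>"
proof (rule ccontr)
  assume neg: "\<not> ?thesis"
  have x: "x \<in> carrier R" "f \<otimes> x = x" and y: "y \<in> carrier R" "f \<otimes> y = y"
    using xf yf by auto
  have e: "e \<in> carrier (corner R e)" by simp
  have ex: "e \<otimes> x = \<zero>" "e \<otimes> y = \<zero>"
    using corner_mult_zero(2)[OF e] xf yf by blast+
  have sum: "e \<oplus> x \<in> carrier R" "e \<otimes> (e \<oplus> x) = e" "(e \<oplus> x) \<otimes> e = e"
    "(e \<oplus> x) \<otimes> y = \<zero>" "y \<otimes> (e \<oplus> x) = \<zero>"
    using x y ex xy m_comm[of x e] m_comm[of y x] m_comm[of y e] by (simp_all add: r_distr l_distr)
  then have "e \<oplus> x \<noteq> \<zero>" "e \<oplus> x \<noteq> y"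
    using assms(2) ex r_null[OF e_closed] by metis+
  moreover have "e \<oplus> x \<noteq> e"
    using x neg add.l_cancel_one' by auto
  moreover have "e \<noteq> f"
    using e_idem ef assms(2) by metis
  \<comment> \<open>Otherwise \<open>x = x \<otimes> f = x \<otimes> y = \<zero>\<close>.\<close>
  moreover have "y \<noteq> f"
    using xy neg x m_comm[of x f] by auto
  moreover have "e \<in> zero_divisors R" "f \<in> zero_divisors R"
    "e \<oplus> x \<in> zero_divisors R" "y \<in> zero_divisors R"
    using assms x y sum neg calculation
    by (auto intro: zero_divisorsI[of e _ f] zero_divisorsI[of f _ e]
        zero_divisorsI[of "e \<oplus> x" _ y] zero_divisorsI[of y _ "e \<oplus> x"])
  ultimately show False
    using threshold_graph_no_alternating_4_cycle[OF assms(1), of "e \<oplus> x" y e f]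
      assms(2) sum x y neg m_comm[of y f] by auto
qed

end

section \<open>Identification of the corners with the two-element field and a finite field\<close>

lemma (in domain) finite_domain_is_field:
  assumes "finite (carrier R)"
  shows "field R"
proof (rule cring_fieldI2)
  fix a assume a: "a \<in> carrier R" "a \<noteq> \<zero>"
  \<comment> \<open>By finiteness this injective map is onto, so it attains
    \<open>\<one>\<close>.\<close>
  have "inj_on ((\<otimes>) a) (carrier R)"
    using a m_lcancel by (auto intro: inj_onI)
  then have "(\<otimes>) a ` carrier R = carrier R"
    using assms a by (intro endo_inj_surj) auto
  then show "\<exists>b\<in>carrier R. a \<otimes> b = \<one>"
    by (metis imageE one_closed)
qed simp

text \<open>The laws for zero and unit determine every entry of the operation tables except
  \<open>\<one> \<oplus> \<one>\<close>, and cancellation forces that one to be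
  \<open>\<zero>\<close>.\<close>

lemma (in ring) two_element_ring_iso:
  assumes c: "carrier R = {\<zero>, \<one>}" and "\<one> \<noteq> \<zero>"
  shows "(\<lambda>x. if x = \<zero> then 0 else 1) \<in> ring_iso R (residue_ring 2)"
proof -
  have "\<one> \<oplus> \<one> \<noteq> \<one>"
    using add.l_cancel_one'[of \<one> \<one>] assms(2) by auto
  then have "\<one> \<oplus> \<one> = \<zero>"
    using c add.m_closed[of \<one> \<one>] by auto
  then show ?thesis
    by (intro ring_iso_memI)
      (use assms(2) in \<open>auto simp: c residue_ring_2_sel bij_betw_def inj_on_def\<close>)
qed

lemma (in complementary_idempotents) threshold_imp_F2_times_field:
  assumes fin: "finite (carrier R)" and "threshold_graph (zero_divisor_graph R)"
    and nz: "e \<noteq> \<zero>" "f \<noteq> \<zero>" and "carrier (corner R e) = {\<zero>, e}"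
  shows "R \<simeq> RDirProd (residue_ring 2) (residue_ring 2) \<or>
    (\<exists>(q :: nat) (F :: int ring). q \<ge> 3 \<and> field F \<and> card (carrier F) = q \<and>
       R \<simeq> RDirProd (residue_ring 2) F)"
proof -
  interpret swap: complementary_idempotents R f e
    by (rule complementary_idempotents_swap)
  interpret E: cring "corner R e"
    by (rule cring_corner)
  let ?K = "corner R f"
  interpret K: cring ?K
    by (rule swap.cring_corner)
  interpret K: domain ?K
    by unfold_locales
      (use nz threshold_imp_corner_integral[OF assms(2) nz] in simp_all)
  have finK: "finite (carrier ?K)"
    using fin by simp
  interpret K: field ?K
    by (rule K.finite_domain_is_field[OF finK])
  have E: "(\<lambda>x. if x = \<zero> then 0 else 1) \<in> ring_iso (corner R e) (residue_ring 2)"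
    using E.two_element_ring_iso nz assms(5) by simp
  \<comment> \<open>The Peirce isomorphism followed by an isomorphism in each component.
    \<open>S\<close> stays arbitrary: it becomes \<open>residue_ring 2\<close> when
    \<open>fR\<close> has two elements, and a copy of \<open>fR\<close> on integers
    otherwise.\<close>
  have iso: "R \<simeq> RDirProd (residue_ring 2) S" if "g \<in> ring_iso ?K S" for g and S :: "int ring"
    using ring_iso_set_trans[OF Peirce_iso RDirProd_iso6[OF E that]]
    unfolding is_ring_iso_def by blast
  show ?thesis
  proof (cases "carrier ?K = {\<zero>, f}")
    case True
    then show ?thesis
      using iso K.two_element_ring_iso nz by auto
  next
    case False
    \<comment> \<open>Numbering the finite carrier lets the field structure be transported along
      \<open>g\<close> to a set of integers of the same size.\<close>
    obtain g :: "'a \<Rightarrow> int" where g: "inj_on g (carrier ?K)"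
      using finite_imp_inj_to_nat_seg[OF finK]
      by (metis comp_inj_on inj_on_subset inj_of_nat subset_UNIV)
    have "{\<zero>, f} \<subset> carrier ?K"
      using False by auto
    then have "card {\<zero>, f} < card (carrier ?K)"
      by (rule psubset_card_mono[OF finK])
    then have "card (carrier (image_ring g ?K)) \<ge> 3"
      using nz card_image[OF g] by (simp add: image_ring_carrier)
    then show ?thesis
      using K.inj_imp_image_ring_is_field[OF g] iso[OF inj_imp_image_ring_iso[OF g]] by blast
  qed
qed

theorem theorem3p4:
  fixes R :: "('a, 'm) ring_scheme"
  assumes "cring R" and "finite (carrier R)" and "\<one>\<^bsub>R\<^esub> \<noteq> \<zero>\<^bsub>R\<^esub>"
    and "\<not> local_ring R"
  shows "threshold_graph (zero_divisor_graph R) \<longleftrightarrow>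
    R \<simeq> RDirProd (residue_ring 2) (residue_ring 2) \<or>
    (\<exists>(q :: nat) (F :: int ring). q \<ge> 3 \<and> field F \<and> card (carrier F) = q \<and>
       R \<simeq> RDirProd (residue_ring 2) F)"
    (is "?L \<longleftrightarrow> ?R")
proof
  interpret cring R by fact
  assume thr: ?L
  obtain e where e: "e \<in> carrier R" "e \<otimes>\<^bsub>R\<^esub> e = e" "e \<noteq> \<zero>\<^bsub>R\<^esub>" "e \<noteq> \<one>\<^bsub>R\<^esub>"
    using non_local_exists_idempotent assms by blast
  define f where "f = \<one>\<^bsub>R\<^esub> \<ominus>\<^bsub>R\<^esub> e"
  have sum: "e \<oplus>\<^bsub>R\<^esub> f = \<one>\<^bsub>R\<^esub>" and f: "f \<in> carrier R"
    using e(1) by (simp_all add: f_def minus_eq a_lcomm[of e] r_neg)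
  interpret complementary_idempotents R e f
    by unfold_locales (use e f sum in \<open>simp_all add: f_def minus_eq r_distr r_minus r_neg\<close>)
  have "f \<noteq> \<zero>\<^bsub>R\<^esub>"
    using sum e by auto
  \<comment> \<open>If \<open>fR\<close> rather than \<open>eR\<close> is the trivial corner, the
    same result is applied with \<open>e\<close> and \<open>f\<close> exchanged.\<close>
  then show ?R
    using threshold_imp_trivial_corner[OF thr] e(3) threshold_imp_F2_times_field[OF assms(2) thr]
      complementary_idempotents.threshold_imp_F2_times_field[OF complementary_idempotents_swap assms(2) thr]
    by blast
next
  have F2: "field (residue_ring 2)"
    using residues_prime.is_field[of 2] by (simp add: residues_prime_def)
  assume ?R
  \<comment> \<open>As \<open>residue_ring 2\<close> is itself a field, both alternatives become
    products with a field and need no separate treatment.\<close>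
  then obtain F :: "int ring" where F: "field F" and "R \<simeq> RDirProd (residue_ring 2) F"
    using F2 by blast
  then obtain h where "h \<in> ring_iso R (RDirProd (residue_ring 2) F)"
    unfolding is_ring_iso_def by blast
  moreover have "ring R" "ring (RDirProd (residue_ring 2) F)"
    using assms(1) F F2 by (auto intro!: RDirProd_ring simp: field_def domain_def cring_def)
  ultimately show ?L
    using threshold_zero_divisor_graph_ring_iso threshold_zero_divisor_graph_F2_times_field[OF F]
    by blast
qed

end
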